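(* Let $G$ be an abelian group, let $A\subset G$ be finite with $\lvert A\rvert=n$, let $h\ge2$, $g\ge1$ be integers and $0<\alpha\le1/h$. Then $$n-b_{h,g}(A)\ \le\ \Bigl(\frac{\mathcal R^{[g]}_{\alpha,h}(A)}{\lvert2-2^\alpha\rvert}\Bigr)^{1/(h\alpha)},$$ or equivalently $\mathcal R^{[g]}_{\alpha,h}(A)\ge\lvert2-2^\alpha\rvert\,(n-b_{h,g}(A))^{h\alpha}$. At $\alpha=1/h$ the bound is linear: $$n-b_{h,g}(A)\ \le\ \frac{\mathcal R^{[g]}_{1/h,h}(A)}{2-2^{1/h}} .$$
   Context: $\mathcal U_h(A)$ is the set of multisets of size $h$ with elements in $A$; $s(u)$ is the sum of $u$ counted with multiplicity; $\nu_u$ is the number of ordered $h$-tuples realizing the multiset $u$ (a multinomial coefficient). A set $B\subset G$ is a $B_h[g]$ set if every element of $G$ equals $s(u)$ for at most $g$ multisets $u\in\mathcal U_h(B)$. $b_{h,g}(A)$ is the largest size of a $B_h[g]$ subset of $A$. Put $$\mathcal R^{[g]}_{\alpha,h}(A):=\inf_{\chi:\mathcal U_h(A)\to\{1,\dots,g\}}\Bigl\lvert\sum_{u\in\mathcal U_h(A)}\nu_u^\alpha-\sum_{(z,c)}\Bigl(\sum_{u:\,s(u)=z,\ \chi(u)=c}\nu_u\Bigr)^{\alpha}\Bigr\rvert,$$ the sum over $(z,c)$ running over the values $z$ of $s$ on $\mathcal U_h(A)$ and $c\in\{1,\dots,g\}$. *)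

theory Defs
  imports Complex_Main "HOL-Library.FuncSet" "HOL-Combinatorics.Multiset_Permutations"
begin

text \<open>The ordered \<open>h\<close>-tuples realizing \<open>u\<close> are the lists \<open>xs\<close> with \<open>mset xs = u\<close>.\<close>

definition mset_weight :: "'a multiset \<Rightarrow> nat" where
  "mset_weight u = card (permutations_of_multiset u)"

text \<open>The finiteness conjunct is needed for infinite \<open>B\<close>, as \<open>card\<close> of an infinite set is \<open>0\<close>.\<close>

definition is_Bhg_set :: "nat \<Rightarrow> nat \<Rightarrow> 'a::ab_group_add set \<Rightarrow> bool" where
  "is_Bhg_set h g B \<longleftrightarrow>
     (\<forall>z. finite {u \<in> multisets_of_size B h. sum_mset u = z} \<and>
          card {u \<in> multisets_of_size B h. sum_mset u = z} \<le> g)"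

definition max_Bhg :: "nat \<Rightarrow> nat \<Rightarrow> 'a::ab_group_add set \<Rightarrow> nat" where
  "max_Bhg h g A = Max (card ` {B. B \<subseteq> A \<and> is_Bhg_set h g B})"

definition colour_defect ::
  "nat \<Rightarrow> real \<Rightarrow> nat \<Rightarrow> 'a::ab_group_add set \<Rightarrow> ('a multiset \<Rightarrow> nat) \<Rightarrow> real" where
  "colour_defect g \<alpha> h A \<chi> =
     \<bar>(\<Sum>u\<in>multisets_of_size A h. real (mset_weight u) powr \<alpha>)
      - (\<Sum>(z, c)\<in>(sum_mset ` multisets_of_size A h) \<times> {1..g}.
           (\<Sum>u\<in>{u \<in> multisets_of_size A h. sum_mset u = z \<and> \<chi> u = c}. real (mset_weight u)) powr \<alpha>)\<bar>"

text \<open>The inner sum above may be empty, in which case its power is \<open>0\<close> since \<open>0 powr \<alpha> = 0\<close>.\<close>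

definition sum_defect :: "nat \<Rightarrow> real \<Rightarrow> nat \<Rightarrow> 'a::ab_group_add set \<Rightarrow> real" where
  "sum_defect g \<alpha> h A =
     (INF \<chi>\<in>multisets_of_size A h \<rightarrow>\<^sub>E {1..g}. colour_defect g \<alpha> h A \<chi>)"

end

theory Submission
  imports Defs
begin

text \<open>
  Fix a colouring. By concavity of \<open>t \<mapsto> t powr \<alpha>\<close>, a class of \<open>k\<close> multisets sharing sum and
  colour contributes at least \<open>(2 - 2 powr \<alpha>) * (k - 1)\<close> to the defect: adding one more multiset
  costs least when all weights involved are \<open>1\<close>. Keeping one multiset per class and deleting from
  \<open>A\<close> one element of every other multiset leaves at most one multiset per class, hence a
  \<open>B\<^sub>h[g]\<close> set. So the number of deleted elements is at most the defect divided by
  \<open>2 - 2 powr \<alpha>\<close>, for every \<open>0 < \<alpha> < 1\<close>. As this number is an integer and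
  \<open>h * \<alpha> \<le> 1\<close>, the bound with exponent \<open>1 / (h * \<alpha>)\<close> is weaker than the linear one.
\<close>

text \<open>This is concavity in difference form: since a - 1 \<le> 0, the power t powr (a - 1)
  decreases in t, which makes the derivative of the difference nonnegative.\<close>

lemma powr_diff_shift_mono:
  fixes a c x y :: real
  assumes "0 \<le> a" "a \<le> 1" "0 \<le> c" "0 < x" "x \<le> y"
  shows "x powr a - (x + c) powr a \<le> y powr a - (y + c) powr a"
proof (rule DERIV_nonneg_imp_nondecreasing[OF \<open>x \<le> y\<close>])
  fix t assume t: "x \<le> t" "t \<le> y"
  have "((\<lambda>t. t powr a - (t + c) powr a) has_real_derivative
          a * t powr (a - 1) - a * (t + c) powr (a - 1)) (at t)"
    using assms t by (auto intro!: derivative_eq_intros)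
  moreover have "(t + c) powr (a - 1) \<le> t powr (a - 1)"
    using assms t by (intro powr_mono2') auto
  hence "0 \<le> a * t powr (a - 1) - a * (t + c) powr (a - 1)"
    using assms by (simp add: mult_left_mono)
  ultimately show "\<exists>d. ((\<lambda>t. t powr a - (t + c) powr a) has_real_derivative d) (at t) \<and> 0 \<le> d"
    by blast
qed

text \<open>The right-hand side increases in each variable, so on x, y \<ge> 1 it is smallest at x =
  y = 1.\<close>

lemma powr_add_defect:
  fixes a x y :: real
  assumes "0 \<le> a" "a \<le> 1" "1 \<le> x" "1 \<le> y"
  shows "2 - 2 powr a \<le> x powr a + y powr a - (x + y) powr a"
  \<comment> \<open>The first instance lowers \<open>x\<close> to 1 with shift \<open>y\<close>; the
    second lowers \<open>y\<close> to 1 with shift 1.\<close>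
  using powr_diff_shift_mono[of a y 1 x] powr_diff_shift_mono[of a 1 1 y] assms
  by (simp add: add.commute)

lemma sum_powr_defect:
  fixes a :: real and w :: "'b \<Rightarrow> real"
  assumes "finite S" and "0 \<le> a" "a \<le> 1" and "\<And>u. u \<in> S \<Longrightarrow> 1 \<le> w u"
  shows "(2 - 2 powr a) * real (card S - 1) \<le> (\<Sum>u\<in>S. w u powr a) - (\<Sum>u\<in>S. w u) powr a"
proof (cases "S = {}")
  case False
  with assms(1) show ?thesis
    using assms(4)
  proof (induction S rule: finite_ne_induct)
    case (insert x F)
    obtain v where "v \<in> F"
      using insert.hyps by blast
    have nonneg: "0 \<le> w u" if "u \<in> F" for u
      using insert.prems[of u] that by simp
    \<comment> \<open>A single member of \<open>F\<close> already pushes the partial sum up to 1, as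
      \<open>powr_add_defect\<close> demands.\<close>
    have "1 \<le> w v"
      using \<open>v \<in> F\<close> insert.prems by simp
    also have "w v \<le> sum w F"
      using \<open>v \<in> F\<close> insert.hyps nonneg by (intro member_le_sum) auto
    finally have "2 - 2 powr a \<le> w x powr a + sum w F powr a - (w x + sum w F) powr a"
      using assms insert.prems by (intro powr_add_defect) auto
    moreover have "(2 - 2 powr a) * real (card F - 1) \<le> (\<Sum>u\<in>F. w u powr a) - (\<Sum>u\<in>F. w u) powr a"
      using insert.IH insert.prems by blast
    \<comment> \<open>As \<open>F\<close> is nonempty, no truncation occurs and the count grows by
      exactly 1.\<close>
    moreover have "real (card (insert x F) - 1) = real (card F - 1) + 1"
      using insert.hyps by (simp add: card_gt_0_iff Suc_leI)
    hence "(2 - 2 powr a) * real (card (insert x F) - 1)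
        = (2 - 2 powr a) * real (card F - 1) + (2 - 2 powr a)"
      by (simp only: distrib_left mult_1_right)
    moreover have sums: "(\<Sum>u\<in>insert x F. w u powr a) = w x powr a + (\<Sum>u\<in>F. w u powr a)"
        "sum w (insert x F) = w x + sum w F"
      using insert.hyps by auto
    ultimately show ?case
      unfolding sums by linarith
  qed simp
qed simp

lemma mset_weight_ge_1: "1 \<le> mset_weight u"
  by (simp add: mset_weight_def Suc_le_eq card_gt_0_iff)

text \<open>The sum charges each class for all its members but one; by truncated subtraction an
  empty class costs 0. Positivity of \<open>h\<close> ensures that each multiset has an element to
  delete.\<close>

lemma exists_Bhg_subset:
  fixes A :: "'a::ab_group_add set"
  assumes "finite A" "0 < h" and "\<chi> \<in> multisets_of_size A h \<rightarrow> {1..g}"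
  defines "cls \<equiv> (\<lambda>p. {u \<in> multisets_of_size A h. sum_mset u = fst p \<and> \<chi> u = snd p})"
  shows "\<exists>B\<subseteq>A. is_Bhg_set h g B \<and>
           card A \<le> card B + (\<Sum>p\<in>(sum_mset ` multisets_of_size A h) \<times> {1..g}. card (cls p) - 1)"
proof -
  let ?U = "multisets_of_size A h"
  let ?P = "(sum_mset ` ?U) \<times> {1..g}"
  have fin: "finite ?U"
    using assms by (simp add: finite_multisets_of_size)
  define rep where "rep p = (SOME u. u \<in> cls p)" for p
  have rep: "rep p \<in> cls p" if "cls p \<noteq> {}" for p
    unfolding rep_def using that by (simp add: some_in_eq)
  define bad where "bad = (\<Union>p\<in>?P. cls p - {rep p})"
  define pick where "pick u = (SOME x. x \<in># u)" for u :: "'a multiset"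
  have pick: "pick u \<in># u" if "u \<in> ?U" for u
  proof -
    have "u \<noteq> {#}"
      using multisets_of_size_size[OF that] assms(2) by auto
    hence "\<exists>x. x \<in># u"
      by blast
    thus ?thesis
      unfolding pick_def by (rule someI_ex)
  qed
  have fin_bad: "finite bad"
    unfolding bad_def cls_def using fin by auto
  define B where "B = A - pick ` bad"
  \<comment> \<open>Otherwise \<open>u\<close> is bad, so its picked element has left
    \<open>A\<close>, although \<open>u\<close> is drawn from \<open>B\<close>.\<close>
  have unique: "u = rep (sum_mset u, \<chi> u)" if "u \<in> multisets_of_size B h" for u
  proof (rule ccontr)
    assume ne: "u \<noteq> rep (sum_mset u, \<chi> u)"
    have U: "u \<in> ?U"
      using that by (auto simp: multisets_of_size_def B_def)
    hence "u \<in> cls (sum_mset u, \<chi> u)" "(sum_mset u, \<chi> u) \<in> ?P"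
      using assms(3) by (auto simp: cls_def)
    hence "u \<in> bad"
      unfolding bad_def using ne by blast
    moreover have "pick u \<in> B"
      using pick[of u] U that by (auto simp: multisets_of_size_def)
    ultimately show False
      by (auto simp: B_def)
  qed
  have "B \<subseteq> A"
    by (auto simp: B_def)
  hence sub: "multisets_of_size B h \<subseteq> ?U"
    by (auto simp: multisets_of_size_def)
  have "is_Bhg_set h g B"
    unfolding is_Bhg_set_def
  proof (intro allI conjI)
    fix z
    let ?S = "{u \<in> multisets_of_size B h. sum_mset u = z}"
    show "finite ?S"
      using sub fin by (auto intro: finite_subset)
    \<comment> \<open>Once the sum is fixed, the colour determines the representative, so the number
      of colours bounds the number of multisets.\<close>
    have "inj_on \<chi> ?S"
    proof (rule inj_onI)
      fix u v assume "u \<in> ?S" "v \<in> ?S" "\<chi> u = \<chi> v"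
      thus "u = v"
        using unique[of u] unique[of v] by simp
    qed
    moreover have "\<chi> ` ?S \<subseteq> {1..g}"
      using assms(3) sub by blast
    ultimately show "card ?S \<le> g"
      using card_inj_on_le[of \<chi> ?S "{1..g}"] by simp
  qed
  moreover have "card A \<le> card B + (\<Sum>p\<in>?P. card (cls p) - 1)"
  proof -
    have "card A \<le> card B + card (pick ` bad)"
      using diff_card_le_card_Diff[of "pick ` bad" A] fin_bad by (simp add: B_def)
    also have "card (pick ` bad) \<le> card bad"
      using fin_bad by (rule card_image_le)
    also have "card bad \<le> (\<Sum>p\<in>?P. card (cls p - {rep p}))"
      unfolding bad_def using fin by (intro card_UN_le) auto
    also have "\<dots> = (\<Sum>p\<in>?P. card (cls p) - 1)"
    proof (rule sum.cong)
      show "card (cls p - {rep p}) = card (cls p) - 1" for p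
        \<comment> \<open>For an empty class \<open>rep p\<close> is arbitrary, but both sides are
          then 0.\<close>
        using rep[of p] by (cases "cls p = {}") auto
    qed simp
    finally show ?thesis
      by simp
  qed
  ultimately show ?thesis
    using \<open>B \<subseteq> A\<close> by auto
qed

lemma card_le_max_Bhg:
  assumes "finite A" "B \<subseteq> A" "is_Bhg_set h g B"
  shows "card B \<le> max_Bhg h g A"
  unfolding max_Bhg_def using assms by (intro Max_ge) auto

lemma colour_defect_ge:
  fixes A :: "'a::ab_group_add set"
  assumes "finite A" "0 < h" "0 \<le> a" "a \<le> 1" and "\<chi> \<in> multisets_of_size A h \<rightarrow> {1..g}"
  shows "(2 - 2 powr a) * (real (card A) - real (max_Bhg h g A)) \<le> colour_defect g a h A \<chi>"
proof -
  let ?U = "multisets_of_size A h"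
  let ?P = "(sum_mset ` ?U) \<times> {1..g}"
  define cls where "cls p = {u \<in> ?U. sum_mset u = fst p \<and> \<chi> u = snd p}" for p
  let ?w = "\<lambda>u. real (mset_weight u)"
  have fin: "finite ?U"
    using assms by (simp add: finite_multisets_of_size)
  obtain B where B: "B \<subseteq> A" "is_Bhg_set h g B" "card A \<le> card B + (\<Sum>p\<in>?P. card (cls p) - 1)"
    using exists_Bhg_subset[OF assms(1,2,5)] unfolding cls_def by auto
  have "real (card A) - real (max_Bhg h g A) \<le> real (\<Sum>p\<in>?P. card (cls p) - 1)"
    using card_le_max_Bhg[OF assms(1) B(1,2)] B(3) by linarith
  moreover have "2 powr a \<le> 2 powr (1::real)"
    using assms by (intro powr_mono) auto
  ultimately have "(2 - 2 powr a) * (real (card A) - real (max_Bhg h g A))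
      \<le> (2 - 2 powr a) * real (\<Sum>p\<in>?P. card (cls p) - 1)"
    by (intro mult_left_mono) auto
  also have "\<dots> = (\<Sum>p\<in>?P. (2 - 2 powr a) * real (card (cls p) - 1))"
    by (simp add: sum_distrib_left)
  also have "\<dots> \<le> (\<Sum>p\<in>?P. (\<Sum>u\<in>cls p. ?w u powr a) - (\<Sum>u\<in>cls p. ?w u) powr a)"
    using fin assms mset_weight_ge_1 unfolding cls_def
    by (intro sum_mono sum_powr_defect) auto
  also have "\<dots> = (\<Sum>u\<in>?U. ?w u powr a) - (\<Sum>p\<in>?P. (\<Sum>u\<in>cls p. ?w u) powr a)"
  proof -
    \<comment> \<open>Colours lie in {1..g}, so each multiset belongs to exactly one class and the
      double sum regroups.\<close>
    have "(\<Sum>p\<in>?P. \<Sum>u | u \<in> ?U \<and> (sum_mset u, \<chi> u) = p. ?w u powr a) = (\<Sum>u\<in>?U. ?w u powr a)"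
      using fin assms(5) by (intro sum.group) auto
    moreover have "cls p = {u. u \<in> ?U \<and> (sum_mset u, \<chi> u) = p}" for p
      unfolding cls_def by (cases p) auto
    ultimately show ?thesis
      by (simp add: sum_subtractf)
  qed
  also have "\<dots> \<le> colour_defect g a h A \<chi>"
    unfolding colour_defect_def cls_def case_prod_unfold by (rule abs_ge_self)
  finally show ?thesis .
qed

text \<open>The lower bound does not depend on the colouring, so it passes to the infimum; g \<ge> 1
  ensures that some colouring exists.\<close>

lemma sum_defect_ge:
  fixes A :: "'a::ab_group_add set"
  assumes "finite A" "0 < h" "1 \<le> g" "0 \<le> a" "a \<le> 1"
  shows "(2 - 2 powr a) * (real (card A) - real (max_Bhg h g A)) \<le> sum_defect g a h A"
  unfolding sum_defect_def
proof (rule cINF_greatest)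
  show "multisets_of_size A h \<rightarrow>\<^sub>E {1..g} \<noteq> {}"
    using assms by (auto simp: PiE_eq_empty_iff)
  show "(2 - 2 powr a) * (real (card A) - real (max_Bhg h g A)) \<le> colour_defect g a h A \<chi>"
    if "\<chi> \<in> multisets_of_size A h \<rightarrow>\<^sub>E {1..g}" for \<chi>
    using that assms by (intro colour_defect_ge) (auto simp: PiE_def)
qed

lemma max_Bhg_le_card:
  fixes A :: "'a::ab_group_add set"
  assumes "finite A" "0 < h"
  shows "max_Bhg h g A \<le> card A"
  unfolding max_Bhg_def
proof (rule Max.boundedI)
  \<comment> \<open>For positive \<open>h\<close> the empty set carries no multiset of size
    \<open>h\<close>. Hence \<open>Max\<close> is taken over a nonempty family.\<close>
  have "is_Bhg_set h g ({} :: 'a set)"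
    using assms by (simp add: is_Bhg_set_def)
  thus "card ` {B. B \<subseteq> A \<and> is_Bhg_set h g B} \<noteq> {}"
    by blast
qed (use assms in \<open>auto intro: card_mono\<close>)

lemma two_powr_less_two:
  fixes a :: real
  assumes "a < 1"
  shows "2 powr a < 2"
  using powr_less_mono[OF assms, of 2] by simp

theorem corollary1p6:
  fixes A :: "'a::ab_group_add set" and n h g :: nat and \<alpha> :: real
  assumes "finite A" and "card A = n"
    and "h \<ge> 2" and "g \<ge> 1"
    and "0 < \<alpha>" and "\<alpha> \<le> 1 / real h"
  shows "real n - real (max_Bhg h g A)
           \<le> (sum_defect g \<alpha> h A / \<bar>2 - 2 powr \<alpha>\<bar>) powr (1 / (real h * \<alpha>))
       \<and> sum_defect g \<alpha> h A
           \<ge> \<bar>2 - 2 powr \<alpha>\<bar> * (real n - real (max_Bhg h g A)) powr (real h * \<alpha>)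
       \<and> real n - real (max_Bhg h g A)
           \<le> sum_defect g (1 / real h) h A / (2 - 2 powr (1 / real h))"
proof -
  define m where "m = n - max_Bhg h g A"
  have m: "real n - real (max_Bhg h g A) = real m"
    using max_Bhg_le_card[of A h g] assms by (simp add: m_def)
  \<comment> \<open>Stated for general \<open>a\<close> because it is used both at \<alpha> and at 1
    / h.\<close>
  have linear: "0 < 2 - 2 powr a \<and> (2 - 2 powr a) * real m \<le> sum_defect g a h A"
    if "0 < a" "a \<le> 1 / real h" for a
  proof -
    have "1 / real h < 1"
      using assms by simp
    hence "a < 1"
      using that by linarith
    thus ?thesis
      using sum_defect_ge[of A h g a] two_powr_less_two[of a] that assms m by auto
  qed
  have pos: "0 < 2 - 2 powr \<alpha>" and lin: "(2 - 2 powr \<alpha>) * real m \<le> sum_defect g \<alpha> h A"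
    using linear[of \<alpha>] assms by auto
  have exponent: "0 < real h * \<alpha>" "real h * \<alpha> \<le> 1"
    using assms by (auto simp: field_simps)
  \<comment> \<open>Integrality enters here: either m = 0, or m \<ge> 1 and an exponent at most 1
    does not increase it.\<close>
  have power: "real m powr (real h * \<alpha>) \<le> real m"
    using exponent powr_mono[of "real h * \<alpha>" 1 "real m"] by (cases "m = 0") auto
  have lower: "(2 - 2 powr \<alpha>) * real m powr (real h * \<alpha>) \<le> sum_defect g \<alpha> h A"
    using mult_left_mono[OF power, of "2 - 2 powr \<alpha>"] pos lin by linarith
  hence "real m powr (real h * \<alpha>) \<le> sum_defect g \<alpha> h A / (2 - 2 powr \<alpha>)"
    using pos by (simp add: field_simps)
  hence "(real m powr (real h * \<alpha>)) powr (1 / (real h * \<alpha>))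
      \<le> (sum_defect g \<alpha> h A / (2 - 2 powr \<alpha>)) powr (1 / (real h * \<alpha>))"
    using exponent by (intro powr_mono2) auto
  moreover have "real h * \<alpha> * (1 / (real h * \<alpha>)) = 1"
    using exponent(1) by (metis less_numeral_extra(3) nonzero_mult_div_cancel_left times_divide_eq_right)
  ultimately have "real m \<le> (sum_defect g \<alpha> h A / (2 - 2 powr \<alpha>)) powr (1 / (real h * \<alpha>))"
    by (metis powr_powr powr_one of_nat_0_le_iff)
  moreover have "real m \<le> sum_defect g (1 / real h) h A / (2 - 2 powr (1 / real h))"
    using linear[of "1 / real h"] assms by (simp add: field_simps)
  ultimately show ?thesis
    using lower pos by (simp add: m)
qed

end
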